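(* Let $n\geq 0$ and $\Pi\subseteq\mathfrak{S}_{n}$. Then $$B(\Pi;y,t)=(1+yt)^{n}P^{(\mathrm{lpk},\mathrm{des})}\left(\Pi;\frac{(1+y)^{2}t}{(y+t)(1+yt)},\frac{y+t}{1+yt}\right).$$ Equivalently, $$P^{(\mathrm{lpk},\mathrm{des})}(\Pi;y,t)=\frac{B(\Pi;u,v)}{(1+uv)^{n}},$$ where $$u=\frac{1+t^{2}-2yt-(1-t)\sqrt{(1+t)^{2}-4yt}}{2(1-y)t},\qquad v=\frac{(1+t)^{2}-2yt-(1+t)\sqrt{(1+t)^{2}-4yt}}{2yt}.$$
   Context: $\mathfrak{S}_n$ is the set of permutations $\pi=\pi_1\cdots\pi_n$ of $[n]=\{1,\dots,n\}$ ($\mathfrak{S}_0$ consists of the empty word only). For $\pi\in\mathfrak{S}_n$: $\mathrm{des}(\pi)$ is the number of $i\in[n-1]$ with $\pi_i>\pi_{i+1}$; $\mathrm{lpk}(\pi)$ is the number of left peaks, where $i\in[n-1]$ is a left peak if either $2\le i\le n-1$ and $\pi_{i-1}<\pi_i>\pi_{i+1}$, or $i=1$ and $\pi_1>\pi_2$ (both statistics are $0$ on the empty word). $\mathfrak{B}_n$ is the set of signed permutations: permutations $\sigma$ of $\{-n,\dots,-1,0,1,\dots,n\}$ with $\sigma_{-i}=-\sigma_i$ for all $i$ (so $\sigma_0=0$), written $\sigma=\sigma_1\cdots\sigma_n$. For $\sigma\in\mathfrak{B}_n$, $\mathrm{des}_B(\sigma)$ is the number of $i\in\{0,1,\dots,n-1\}$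 with $\sigma_i>\sigma_{i+1}$ (where $\sigma_0=0$), and $\mathrm{neg}(\sigma)$ is the number of $i\in[n]$ with $\sigma_i<0$. For $\pi\in\mathfrak{S}_n$, $\mathfrak{B}(\pi)\subseteq\mathfrak{B}_n$ is the set of the $2^n$ signed permutations obtained by choosing any subset of the letters of $\pi$ and replacing them with their negatives; for $\Pi\subseteq\mathfrak{S}_n$, $\mathfrak{B}(\Pi)=\bigcup_{\pi\in\Pi}\mathfrak{B}(\pi)$. Define $B(\Pi;y,t)=\sum_{\sigma\in\mathfrak{B}(\Pi)}y^{\mathrm{neg}(\sigma)}t^{\mathrm{des}_B(\sigma)}$ and $P^{(\mathrm{lpk},\mathrm{des})}(\Pi;y,t)=\sum_{\pi\in\Pi}y^{\mathrm{lpk}(\pi)}t^{\mathrm{des}(\pi)}$. Here $y,t$ are indeterminates; the first identity is an identity of rational functions in $y,t$. In the second identity, $\sqrt{(1+t)^2-4yt}$ is the formal power series in $t$ over $\mathbb{Q}[y]$ with constant term $1$, so that $u$ and $v$ are formal power series in $t$ with coefficients in $\mathbb{Q}[y]$. *)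

theory Defs
  imports
    "HOL-Combinatorics.Permutations"
    "HOL-Computational_Algebra.Computational_Algebra"
begin

section \<open>Permutations, signed permutations and their statistics\<close>

text \<open>The word \<open>\<pi>\<^sub>1 \<dots> \<pi>\<^sub>n\<close> is the function \<open>\<pi>\<close> restricted to \<open>{1..n}\<close>; by \<open>permutes\<close>, the function is
  the identity elsewhere, so that distinct functions correspond to distinct words.\<close>

definition perms :: "nat \<Rightarrow> (nat \<Rightarrow> nat) set" where
  "perms n = {\<pi>. \<pi> permutes {1..n}}"

definition des :: "nat \<Rightarrow> (nat \<Rightarrow> nat) \<Rightarrow> nat" where
  "des n \<pi> = card {i \<in> {1..<n}. \<pi> i > \<pi> (i + 1)}"

definition lpk :: "nat \<Rightarrow> (nat \<Rightarrow> nat) \<Rightarrow> nat" where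
  "lpk n \<pi> = card {i \<in> {1..<n}.
     (2 \<le> i \<and> \<pi> (i - 1) < \<pi> i \<and> \<pi> i > \<pi> (i + 1)) \<or> (i = 1 \<and> \<pi> 1 > \<pi> 2)}"

definition signed_perms :: "nat \<Rightarrow> (int \<Rightarrow> int) set" where
  "signed_perms n = {\<sigma>. \<sigma> permutes {- int n..int n} \<and> (\<forall>i. \<sigma> (- i) = - \<sigma> i)}"

definition des_B :: "nat \<Rightarrow> (int \<Rightarrow> int) \<Rightarrow> nat" where
  "des_B n \<sigma> = card {i \<in> {0..<int n}. \<sigma> i > \<sigma> (i + 1)}"

definition neg :: "nat \<Rightarrow> (int \<Rightarrow> int) \<Rightarrow> nat" where
  "neg n \<sigma> = card {i \<in> {1..int n}. \<sigma> i < 0}"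

text \<open>Here \<open>S\<close> is the set of letters of \<open>\<pi>\<close> that are replaced with their negatives.\<close>

definition signings :: "nat \<Rightarrow> (nat \<Rightarrow> nat) \<Rightarrow> (int \<Rightarrow> int) set" where
  "signings n \<pi> = {\<sigma> \<in> signed_perms n. \<exists>S \<subseteq> {1..n}. \<forall>i \<in> {1..n}.
     \<sigma> (int i) = (if \<pi> i \<in> S then - int (\<pi> i) else int (\<pi> i))}"

definition B_poly :: "nat \<Rightarrow> (nat \<Rightarrow> nat) set \<Rightarrow> 'a \<Rightarrow> 'a \<Rightarrow> 'a::comm_semiring_1" where
  "B_poly n A y t = (\<Sum>\<sigma> \<in> (\<Union>\<pi>\<in>A. signings n \<pi>). y ^ neg n \<sigma> * t ^ des_B n \<sigma>)"

definition P_lpk_des :: "nat \<Rightarrow> (nat \<Rightarrow> nat) set \<Rightarrow> 'a \<Rightarrow> 'a \<Rightarrow> 'a::comm_semiring_1" where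
  "P_lpk_des n A y t = (\<Sum>\<pi>\<in>A. y ^ lpk n \<pi> * t ^ des n \<pi>)"


section \<open>The indeterminates as rational functions\<close>

text \<open>The field \<open>\<rat>(y,t)\<close> is the fraction field of \<open>\<rat>[y][t]\<close>: the inner polynomial variable is \<open>y\<close>,
  the outer one is \<open>t\<close>.\<close>

definition y_rat :: "rat poly poly fract" where
  "y_rat = to_fract [:[:0, 1:]:]"

definition t_rat :: "rat poly poly fract" where
  "t_rat = to_fract [:0, 1:]"


section \<open>The power series \<open>u\<close> and \<open>v\<close>\<close>

text \<open>The ring \<open>\<rat>[y][[t]]\<close> is \<^typ>\<open>rat poly fps\<close>. Quotients are formed in the field
  \<open>\<rat>(y)((t))\<close>, into which \<open>\<rat>[y][[t]]\<close> embeds. (Division on \<^typ>\<open>'a fps\<close> needs inverses of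
  coefficients, and drops terms if the subdegree of the divisor is too large.)\<close>

definition embed_ser :: "rat poly fps \<Rightarrow> rat poly fract fls" where
  "embed_ser f = fps_to_fls (Abs_fps (\<lambda>n. to_fract (fps_nth f n)))"

definition y_fps :: "rat poly fps" where
  "y_fps = fps_const [:0, 1:]"

definition t_fps :: "rat poly fps" where
  "t_fps = fps_X"

definition sqrt_disc :: "rat poly fps" where
  "sqrt_disc = (THE s. s ^ 2 = (1 + t_fps) ^ 2 - 4 * y_fps * t_fps \<and> fps_nth s 0 = 1)"

definition y_ser :: "rat poly fract fls" where
  "y_ser = embed_ser y_fps"

definition t_ser :: "rat poly fract fls" where
  "t_ser = embed_ser t_fps"

definition u_ser :: "rat poly fract fls" where
  "u_ser = (1 + t_ser ^ 2 - 2 * y_ser * t_ser - (1 - t_ser) * embed_ser sqrt_disc)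
             / (2 * (1 - y_ser) * t_ser)"

definition v_ser :: "rat poly fract fls" where
  "v_ser = ((1 + t_ser) ^ 2 - 2 * y_ser * t_ser - (1 + t_ser) * embed_ser sqrt_disc)
             / (2 * y_ser * t_ser)"


subsection \<open>Well-definedness\<close>

lemma sqrt_disc_ex1:
  "\<exists>!s :: rat poly fps. s ^ 2 = (1 + t_fps) ^ 2 - 4 * y_fps * t_fps \<and> fps_nth s 0 = 1"
proof (rule ex_ex1I)
  define D :: "rat poly fps" where "D = (1 + t_fps) ^ 2 - 4 * y_fps * t_fps"
  define h :: "rat poly fps" where "h = Abs_fps (\<lambda>n. [:(1/2) gchoose n:])"
  have D0: "fps_nth (D - 1) 0 = 0"
    by (simp add: D_def t_fps_def y_fps_def power2_eq_square)
  have bin: "fps_binomial (1/2 :: rat) * fps_binomial (1/2) = 1 + fps_X"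
    by (simp flip: fps_binomial_add_mult add: fps_binomial_1)
  have "h * h = 1 + fps_X"
  proof (rule fps_ext)
    fix n
    have "fps_nth (h * h) n = [:fps_nth (fps_binomial (1/2 :: rat) * fps_binomial (1/2)) n:]"
      by (simp add: h_def fps_mult_nth poly_eq_iff coeff_sum coeff_pCons mult.commute split: nat.split)
    also have "\<dots> = fps_nth (1 + fps_X) n"
      unfolding bin by (simp add: one_pCons)
    finally show "fps_nth (h * h) n = fps_nth (1 + fps_X) n" .
  qed
  hence "(h oo (D - 1)) * (h oo (D - 1)) = (1 + fps_X) oo (D - 1)"
    by (metis fps_compose_mult_distrib[OF D0])
  also have "\<dots> = D"
    using D0 by (simp add: fps_compose_add_distrib)
  finally have "(h oo (D - 1)) ^ 2 = D"
    by (simp add: power2_eq_square)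
  moreover have "fps_nth (h oo (D - 1)) 0 = 1"
    by (simp add: h_def one_pCons)
  ultimately show "\<exists>s :: rat poly fps. s ^ 2 = (1 + t_fps) ^ 2 - 4 * y_fps * t_fps \<and> fps_nth s 0 = 1"
    unfolding D_def by blast
next
  fix s s' :: "rat poly fps"
  assume s: "s ^ 2 = (1 + t_fps) ^ 2 - 4 * y_fps * t_fps \<and> fps_nth s 0 = 1"
    and s': "s' ^ 2 = (1 + t_fps) ^ 2 - 4 * y_fps * t_fps \<and> fps_nth s' 0 = 1"
  hence "s = s' \<or> s = - s'"
    by (metis power2_eq_iff)
  with s s' show "s = s'"
    by auto
qed

lemma sqrt_disc:
  "sqrt_disc ^ 2 = (1 + t_fps) ^ 2 - 4 * y_fps * t_fps" "fps_nth sqrt_disc 0 = 1"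
  using theI'[OF sqrt_disc_ex1] unfolding sqrt_disc_def by blast+

lemma embed_ser_add: "embed_ser (f + g) = embed_ser f + embed_ser g"
proof -
  have "Abs_fps (\<lambda>n. to_fract (fps_nth (f + g) n)) =
        Abs_fps (\<lambda>n. to_fract (fps_nth f n)) + Abs_fps (\<lambda>n. to_fract (fps_nth g n))"
    by (rule fps_ext) simp
  thus ?thesis by (simp add: embed_ser_def)
qed

lemma embed_ser_diff: "embed_ser (f - g) = embed_ser f - embed_ser g"
  using embed_ser_add[of "f - g" g] by simp

lemma embed_ser_mult: "embed_ser (f * g) = embed_ser f * embed_ser g"
proof -
  have sum: "to_fract (sum h A) = (\<Sum>a\<in>A. to_fract (h a))" for h :: "nat \<Rightarrow> rat poly" and A
    by (induction A rule: infinite_finite_induct) auto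
  have "Abs_fps (\<lambda>n. to_fract (fps_nth (f * g) n)) =
        Abs_fps (\<lambda>n. to_fract (fps_nth f n)) * Abs_fps (\<lambda>n. to_fract (fps_nth g n))"
    by (rule fps_ext) (simp add: fps_mult_nth sum)
  thus ?thesis by (simp add: embed_ser_def fls_times_fps_to_fls)
qed

lemma embed_ser_1 [simp]: "embed_ser 1 = 1"
proof -
  have "Abs_fps (\<lambda>n. to_fract (fps_nth (1 :: rat poly fps) n)) = 1"
    by (rule fps_ext) simp
  thus ?thesis by (simp add: embed_ser_def)
qed

lemma embed_ser_eq_iff [simp]: "embed_ser f = embed_ser g \<longleftrightarrow> f = g"
  by (auto simp: embed_ser_def fps_eq_iff)

lemma embed_ser_power: "embed_ser (f ^ k) = embed_ser f ^ k"
  by (induction k) (simp_all add: embed_ser_mult)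

lemma embed_ser_2: "embed_ser 2 = 2"
  using embed_ser_add[of 1 1] by simp

lemmas embed_ser_simps = embed_ser_add embed_ser_diff embed_ser_mult embed_ser_power embed_ser_2

lemma y_ser_eq: "y_ser = fls_const (to_fract [:0, 1:])"
proof -
  have "Abs_fps (\<lambda>n. to_fract (fps_nth y_fps n)) = fps_const (to_fract [:0, 1:])"
    by (rule fps_ext) (simp add: y_fps_def)
  thus ?thesis by (simp add: y_ser_def embed_ser_def fls_const_def)
qed

lemma t_ser_eq: "t_ser = fls_X"
proof -
  have "Abs_fps (\<lambda>n. to_fract (fps_nth t_fps n)) = fps_X"
    by (rule fps_ext) (simp add: t_fps_def)
  thus ?thesis by (simp add: t_ser_def embed_ser_def)
qed

text \<open>A series in \<open>\<rat>[y][[t]]\<close> is divisible by \<open>2 (y - a) t\<close> if it vanishes at \<open>t = 0\<close> and at \<open>y = a\<close>.\<close>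

definition eval_y :: "rat \<Rightarrow> rat poly fps \<Rightarrow> rat fps" where
  "eval_y a f = Abs_fps (\<lambda>n. poly (fps_nth f n) a)"

lemma eval_y_simps:
  "eval_y a (f + g) = eval_y a f + eval_y a g"
  "eval_y a (f - g) = eval_y a f - eval_y a g"
  "eval_y a (f * g) = eval_y a f * eval_y a g"
  "eval_y a 1 = 1"
  "eval_y a y_fps = fps_const a"
  "eval_y a t_fps = fps_X"
  by (simp_all add: eval_y_def fps_eq_iff fps_mult_nth poly_sum y_fps_def t_fps_def)

lemma eval_y_numeral: "eval_y a (numeral k) = numeral k"
  by (induction k) (simp_all only: numeral.simps eval_y_simps)

lemma divisible_by_linear_t:
  assumes "fps_nth f 0 = 0" and "eval_y a f = 0"
  shows "\<exists>g. f = 2 * (y_fps - fps_const [:a:]) * t_fps * g"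
proof -
  define g where "g = Abs_fps (\<lambda>n. smult (1/2) (fps_nth f (Suc n) div [:- a, 1:]))"
  have dvd: "[:- a, 1:] dvd fps_nth f n" for n
    using assms(2) by (simp add: eval_y_def fps_eq_iff poly_eq_0_iff_dvd)
  have "2 * (y_fps - fps_const [:a:]) = fps_const (2 * [:- a, 1:])"
    by (simp add: y_fps_def fps_numeral_fps_const flip: fps_const_mult)
  hence "2 * (y_fps - fps_const [:a:]) * t_fps * g = fps_const (2 * [:- a, 1:]) * (fps_X * g)"
    by (simp only: t_fps_def mult.assoc)
  also have "\<dots> = f"
  proof (rule fps_ext)
    fix n
    show "fps_nth (fps_const (2 * [:- a, 1:]) * (fps_X * g)) n = fps_nth f n"
    proof (cases n)
      case (Suc m)
      have "fps_nth (fps_const (2 * [:- a, 1:]) * (fps_X * g)) n =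
            (2 * [:- a, 1:]) * smult (1/2) (fps_nth f n div [:- a, 1:])"
        by (simp only: fps_mult_left_const_nth) (simp add: Suc g_def)
      also have "\<dots> = smult (1/2) (2 * ([:- a, 1:] * (fps_nth f n div [:- a, 1:])))"
        by (simp only: mult_smult_right mult.assoc)
      also have "\<dots> = smult (1/2) (2 * fps_nth f n)"
        by (simp only: dvd_mult_div_cancel[OF dvd])
      also have "\<dots> = fps_nth f n"
        by (simp add: numeral_poly)
      finally show ?thesis .
    qed (use assms in simp)
  qed
  finally show ?thesis by metis
qed

lemma eval_y_sqrt_disc:
  "eval_y 0 sqrt_disc = 1 + fps_X" "eval_y 1 sqrt_disc = 1 - fps_X"
proof -
  have sq: "eval_y a sqrt_disc ^ 2 = (1 + fps_X) ^ 2 - 4 * fps_const a * fps_X" for a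
    using arg_cong[OF sqrt_disc(1), of "eval_y a"]
    by (simp add: power2_eq_square eval_y_simps eval_y_numeral)
  have c: "fps_nth (eval_y a sqrt_disc) 0 = 1" for a
    by (simp add: eval_y_def sqrt_disc(2))
  have "eval_y 0 sqrt_disc ^ 2 = (1 + fps_X) ^ 2"
    using sq[of 0] by simp
  hence "eval_y 0 sqrt_disc = 1 + fps_X \<or> eval_y 0 sqrt_disc = - (1 + fps_X)"
    by (simp only: power2_eq_iff)
  thus "eval_y 0 sqrt_disc = 1 + fps_X"
    using c[of 0] by auto
  have "eval_y 1 sqrt_disc ^ 2 = (1 - fps_X) ^ 2"
    using sq[of 1] by (simp add: power2_eq_square algebra_simps)
  hence "eval_y 1 sqrt_disc = 1 - fps_X \<or> eval_y 1 sqrt_disc = - (1 - fps_X)"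
    by (simp only: power2_eq_iff)
  thus "eval_y 1 sqrt_disc = 1 - fps_X"
    using c[of 1] by auto
qed

lemma y_ser_neq: "y_ser \<noteq> 0" "y_ser \<noteq> 1" "t_ser \<noteq> 0"
proof -
  have "[:0, 1:] \<noteq> (1 :: rat poly)" by (simp add: one_pCons)
  hence "to_fract [:0, 1 :: rat:] \<noteq> to_fract 1" unfolding to_fract_eq_iff .
  thus "y_ser \<noteq> 1" unfolding y_ser_eq by (metis fls_const_1 fls_const_nth to_fract_1)
qed (auto simp: y_ser_eq t_ser_eq)

lemma u_ser_power_series: "\<exists>!f. u_ser = embed_ser f"
proof -
  define N where "N = 1 + t_fps ^ 2 - 2 * y_fps * t_fps - (1 - t_fps) * sqrt_disc"
  have "fps_nth N 0 = 0"
    by (simp add: N_def t_fps_def sqrt_disc(2) power2_eq_square)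
  moreover have "eval_y 1 N = 0"
    by (simp add: N_def eval_y_simps eval_y_numeral power2_eq_square eval_y_sqrt_disc algebra_simps)
  ultimately obtain g where g: "N = 2 * (y_fps - fps_const [:1:]) * t_fps * g"
    using divisible_by_linear_t by blast
  hence "N = 2 * (1 - y_fps) * t_fps * (- g)"
    by (simp add: algebra_simps flip: one_pCons)
  hence "embed_ser N = 2 * (1 - y_ser) * t_ser * embed_ser (- g)"
    by (simp only: embed_ser_simps embed_ser_1 y_ser_def t_ser_def)
  hence "u_ser = embed_ser (- g)"
    using y_ser_neq by (simp add: u_ser_def N_def embed_ser_simps flip: y_ser_def t_ser_def)
  thus ?thesis by (metis embed_ser_eq_iff)
qed

lemma v_ser_power_series: "\<exists>!f. v_ser = embed_ser f"
proof -
  define N where "N = (1 + t_fps) ^ 2 - 2 * y_fps * t_fps - (1 + t_fps) * sqrt_disc"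
  have "fps_nth N 0 = 0"
    by (simp add: N_def t_fps_def sqrt_disc(2) power2_eq_square)
  moreover have "eval_y 0 N = 0"
    by (simp add: N_def eval_y_simps eval_y_numeral power2_eq_square eval_y_sqrt_disc algebra_simps)
  ultimately obtain g where g: "N = 2 * (y_fps - fps_const [:0:]) * t_fps * g"
    using divisible_by_linear_t by blast
  hence "embed_ser N = 2 * y_ser * t_ser * embed_ser g"
    by (simp add: embed_ser_simps y_ser_def t_ser_def)
  hence "v_ser = embed_ser g"
    using y_ser_neq by (simp add: v_ser_def N_def embed_ser_simps flip: y_ser_def t_ser_def)
  thus ?thesis by (metis embed_ser_eq_iff)
qed

end

theory Submission
  imports Defs
begin

text \<open>
  Put \<open>\<pi>\<^sub>0 = 0\<close>. At an ascent \<open>\<pi>\<^sub>i < \<pi>\<^sub>i\<^sub>+\<^sub>1\<close>, the signed word has a descent iff the letter \<open>\<pi>\<^sub>i\<^sub>+\<^sub>1\<close> is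
  negated; at a descent of \<open>\<pi>\<close>, iff the letter \<open>\<pi>\<^sub>i\<close> is not negated. Hence the sum over the signings
  of \<open>\<pi>\<close> is a product over the letters: a peak contributes \<open>(1 + y) t\<close>, a valley \<open>1 + y\<close>, a double
  descent \<open>y + t\<close> and a double ascent \<open>1 + y t\<close>. Since left peaks and valleys alternate, the product
  is \<open>((1 + y)\<^sup>2 t)\<^sup>k (y + t)\<^sup>d\<^sup>-\<^sup>k (1 + y t)\<^sup>n\<^sup>-\<^sup>k\<^sup>-\<^sup>d\<close> with \<open>k = lpk \<pi>\<close> and \<open>d = des \<pi>\<close>. Both identities follow, the
  second because \<open>u\<close> and \<open>v\<close> solve \<open>u + v = t (1 + u v)\<close> and \<open>(1 + u)\<^sup>2 v = y t (1 + u v)\<^sup>2\<close>.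
\<close>

section \<open>Descent sets and left peaks\<close>

definition descents :: "nat \<Rightarrow> (nat \<Rightarrow> nat) \<Rightarrow> nat set" where
  "descents n \<pi> = {i \<in> {1..<n}. \<pi> i > \<pi> (i + 1)}"

text \<open>A left peak is the start of a maximal run of consecutive descents: adjacent letters
  differ, so a non-descent inside the word is an ascent. Position 1 fits the same rule because 0 is
  never in the descent set.\<close>

lemma lpk_eq:
  assumes "\<pi> permutes {1..n}"
  shows "lpk n \<pi> = card {i \<in> descents n \<pi>. i - 1 \<notin> descents n \<pi>}"
proof -
  have "(2 \<le> i \<and> \<pi> (i - 1) < \<pi> i \<and> \<pi> i > \<pi> (i + 1)) \<or> (i = 1 \<and> \<pi> 1 > \<pi> 2) \<longleftrightarrow>
        \<pi> i > \<pi> (i + 1) \<and> i - 1 \<notin> descents n \<pi>" if i: "i \<in> {1..<n}" for i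
  proof (cases "i = 1")
    case True
    thus ?thesis by (simp add: descents_def numeral_2_eq_2)
  next
    case False
    with i have "i = Suc (Suc (i - 2))" by auto
    then obtain k where k: "i = Suc (Suc k)" by blast
    have "\<pi> (Suc k) \<noteq> \<pi> (Suc (Suc k))"
      using inj_eq[OF permutes_inj[OF assms]] by simp
    thus ?thesis using i by (auto simp: k descents_def)
  qed
  hence "{i \<in> {1..<n}. (2 \<le> i \<and> \<pi> (i - 1) < \<pi> i \<and> \<pi> i > \<pi> (i + 1)) \<or> (i = 1 \<and> \<pi> 1 > \<pi> 2)} =
        {i \<in> descents n \<pi>. i - 1 \<notin> descents n \<pi>}"
    unfolding descents_def by blast
  thus ?thesis by (simp add: lpk_def)
qed

lemma permutes_pos:
  fixes \<pi> :: "nat \<Rightarrow> nat"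
  assumes "\<pi> permutes {1..n}" "i \<in> {1..n}"
  shows "\<pi> i > 0"
proof -
  have "\<pi> i \<in> {1..n}" using assms by (simp only: permutes_in_image)
  thus ?thesis by auto
qed

lemma prod_if_card:
  fixes c :: "'a::comm_semiring_1"
  assumes "finite I"
  shows "(\<Prod>i\<in>I. if P i then c else 1) = c ^ card {i \<in> I. P i}"
  using prod.inter_filter[OF assms, of "\<lambda>_. c" P] by simp


subsection \<open>The signings of a permutation\<close>

text \<open>Here \<open>T\<close> is the set of positions, not of letters, whose sign is changed.\<close>

definition sign_word :: "(nat \<Rightarrow> nat) \<Rightarrow> nat set \<Rightarrow> int \<Rightarrow> int" where
  "sign_word \<pi> T j = (if nat \<bar>j\<bar> \<in> T then - sgn j else sgn j) * int (\<pi> (nat \<bar>j\<bar>))"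

lemma sign_word_minus: "sign_word \<pi> T (- j) = - sign_word \<pi> T j"
  by (simp add: sign_word_def)

lemma sign_word_int:
  "sign_word \<pi> T (int i) = (if i = 0 then 0 else if i \<in> T then - int (\<pi> i) else int (\<pi> i))"
  by (simp add: sign_word_def sgn_if)

lemma abs_sign_word:
  assumes "\<pi> permutes {1..n}"
  shows "\<bar>sign_word \<pi> T j\<bar> = int (\<pi> (nat \<bar>j\<bar>))"
  using permutes_not_in[OF assms, of 0] by (simp add: sign_word_def sgn_if)

lemma sign_word_in_signed_perms:
  assumes \<pi>: "\<pi> permutes {1..n}" and T: "T \<subseteq> {1..n}"
  shows "sign_word \<pi> T \<in> signed_perms n"
proof -
  have \<pi>0: "\<pi> i = 0 \<longleftrightarrow> i = 0" for i
    using permutes_not_in[OF \<pi>, of 0] inj_eq[OF permutes_inj[OF \<pi>], of i 0] by simp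
  have "inj (sign_word \<pi> T)"
  proof (rule injI)
    fix i j assume eq: "sign_word \<pi> T i = sign_word \<pi> T j"
    hence "\<pi> (nat \<bar>i\<bar>) = \<pi> (nat \<bar>j\<bar>)"
      using abs_sign_word[OF \<pi>] by (metis of_nat_eq_iff)
    hence "nat \<bar>i\<bar> = nat \<bar>j\<bar>"
      using inj_eq[OF permutes_inj[OF \<pi>]] by auto
    hence "i = j \<or> i = - j" by linarith
    \<comment> \<open>Absolute values fix a position only up to sign. Oddness then makes the common
      value its own negative, hence 0, and \<open>\<pi>\<close> takes the value 0 only at 0.\<close>
    moreover have "j = 0" if "i = - j"
    proof -
      have "sign_word \<pi> T j = 0"
        using eq sign_word_minus[of \<pi> T j] that by simp
      hence "\<pi> (nat \<bar>j\<bar>) = 0"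
        using abs_sign_word[OF \<pi>, of T j] by simp
      thus "j = 0" using \<pi>0 by simp
    qed
    ultimately show "i = j" by auto
  qed
  moreover have "sign_word \<pi> T j \<in> {- int n..int n}" if "j \<in> {- int n..int n}" for j
  proof -
    have "\<pi> (nat \<bar>j\<bar>) \<le> n"
    proof (cases "j = 0")
      case False
      hence "nat \<bar>j\<bar> \<in> {1..n}" using that by auto
      thus ?thesis using permutes_in_image[OF \<pi>] by (metis atLeastAtMost_iff)
    qed (use \<pi>0[of 0] in simp)
    thus ?thesis using abs_sign_word[OF \<pi>, of T j] by auto
  qed
  ultimately have "bij_betw (sign_word \<pi> T) {- int n..int n} {- int n..int n}"
    using endo_inj_surj[of "{- int n..int n}" "sign_word \<pi> T"] inj_on_subset[OF _ subset_UNIV]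
    unfolding bij_betw_def by blast
  moreover have "sign_word \<pi> T j = j" if "j \<notin> {- int n..int n}" for j
  proof -
    have "nat \<bar>j\<bar> \<notin> {1..n}" using that by auto
    hence "\<pi> (nat \<bar>j\<bar>) = nat \<bar>j\<bar>" "nat \<bar>j\<bar> \<notin> T"
      using permutes_not_in[OF \<pi>] T by auto
    thus ?thesis by (simp add: sign_word_def sgn_if)
  qed
  ultimately have "sign_word \<pi> T permutes {- int n..int n}"
    by (rule bij_imp_permutes)
  thus ?thesis by (simp add: signed_perms_def sign_word_minus)
qed

lemma signed_perms_eqI:
  assumes "\<sigma> \<in> signed_perms n" "\<tau> \<in> signed_perms n"
    and eq: "\<And>i. i \<in> {1..n} \<Longrightarrow> \<sigma> (int i) = \<tau> (int i)"
  shows "\<sigma> = \<tau>"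
proof
  fix j
  have odd: "\<sigma> (- i) = - \<sigma> i" "\<tau> (- i) = - \<tau> i" for i
    using assms(1,2) by (auto simp: signed_perms_def)
  show "\<sigma> j = \<tau> j"
  proof (cases "j = 0 \<or> j \<notin> {- int n..int n}")
    case True
    thus ?thesis
      using assms(1,2) odd[of 0] by (auto simp: signed_perms_def permutes_not_in)
  next
    case False
    hence "nat \<bar>j\<bar> \<in> {1..n}" by auto
    hence "\<sigma> \<bar>j\<bar> = \<tau> \<bar>j\<bar>" using eq by fastforce
    thus ?thesis using odd[of "\<bar>j\<bar>"] by (cases "j \<ge> 0") simp_all
  qed
qed

lemma signings_eq:
  assumes \<pi>: "\<pi> permutes {1..n}"
  shows "signings n \<pi> = sign_word \<pi> ` Pow {1..n}"
proof (intro equalityI subsetI)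
  fix \<sigma> assume "\<sigma> \<in> signings n \<pi>"
  then obtain S where \<sigma>: "\<sigma> \<in> signed_perms n"
    and S: "\<And>i. i \<in> {1..n} \<Longrightarrow> \<sigma> (int i) = (if \<pi> i \<in> S then - int (\<pi> i) else int (\<pi> i))"
    by (auto simp: signings_def)
  define T where "T = {i \<in> {1..n}. \<pi> i \<in> S}"
  have "\<sigma> = sign_word \<pi> T"
    by (rule signed_perms_eqI[OF \<sigma> sign_word_in_signed_perms[OF \<pi>]])
      (auto simp: T_def S sign_word_int)
  thus "\<sigma> \<in> sign_word \<pi> ` Pow {1..n}" by (auto simp: T_def)
next
  fix \<sigma> assume "\<sigma> \<in> sign_word \<pi> ` Pow {1..n}"
  then obtain T where T: "T \<subseteq> {1..n}" and \<sigma>: "\<sigma> = sign_word \<pi> T" by auto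
  have "\<pi> ` T \<subseteq> {1..n}"
    using T permutes_image[OF \<pi>] by blast
  moreover have "\<pi> i \<in> \<pi> ` T \<longleftrightarrow> i \<in> T" for i
    using inj_eq[OF permutes_inj[OF \<pi>]] by auto
  ultimately show "\<sigma> \<in> signings n \<pi>"
    unfolding signings_def \<sigma>
    by (auto simp: sign_word_in_signed_perms[OF \<pi> T] sign_word_int intro!: exI[of _ "\<pi> ` T"])
qed

text \<open>The letters of \<open>\<pi>\<close> are positive, so the signs of the word reveal
  \<open>T\<close>. This permits reindexing sums over signings by subsets.\<close>

lemma inj_on_sign_word:
  assumes \<pi>: "\<pi> permutes {1..n}"
  shows "inj_on (sign_word \<pi>) (Pow {1..n})"
proof (rule inj_onI)
  fix T T' assume T: "T \<in> Pow {1..n}" "T' \<in> Pow {1..n}" and eq: "sign_word \<pi> T = sign_word \<pi> T'"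
  have "i \<in> T \<longleftrightarrow> i \<in> T'" if "i \<in> {1..n}" for i
  proof -
    have "\<pi> i > 0" using permutes_pos[OF \<pi> that] .
    thus ?thesis
      using fun_cong[OF eq, of "int i"] that by (auto simp: sign_word_int split: if_splits)
  qed
  thus "T = T'" using T by blast
qed

text \<open>Absolute values recover the underlying permutation. Hence the sum over the union in
  \<open>B_poly\<close> splits into sums over single permutations.\<close>

lemma signings_disjoint:
  assumes "\<pi> permutes {1..n}" "\<rho> permutes {1..n}" "\<pi> \<noteq> \<rho>"
  shows "signings n \<pi> \<inter> signings n \<rho> = {}"
proof (rule ccontr)
  assume "signings n \<pi> \<inter> signings n \<rho> \<noteq> {}"
  then obtain T T' where "sign_word \<pi> T = sign_word \<rho> T'"
    using assms by (auto simp: signings_eq)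
  hence "int (\<pi> i) = int (\<rho> i)" for i
    using abs_sign_word[OF assms(1), of T "int i"] abs_sign_word[OF assms(2), of T' "int i"] by simp
  with assms(3) show False by auto
qed


subsection \<open>The sum over the signings as a product over the letters\<close>

lemma neg_sign_word:
  assumes \<pi>: "\<pi> permutes {1..n}" and T: "T \<subseteq> {1..n}"
  shows "neg n (sign_word \<pi> T) = card T"
proof -
  have "{i \<in> {1..int n}. sign_word \<pi> T i < 0} = int ` T"
  proof (intro equalityI subsetI)
    fix j assume "j \<in> {i \<in> {1..int n}. sign_word \<pi> T i < 0}"
    hence "0 \<le> j" "sign_word \<pi> T j < 0" by simp_all
    moreover from this obtain i where i: "j = int i"
      using nonneg_int_cases by blast
    ultimately have "sign_word \<pi> T (int i) < 0" by simp
    with i show "j \<in> int ` T" unfolding sign_word_int by (auto split: if_splits)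
  next
    fix j assume "j \<in> int ` T"
    then obtain i where i: "i \<in> T" "j = int i" by auto
    moreover have "\<pi> i > 0" using permutes_pos[OF \<pi>] i T by blast
    ultimately show "j \<in> {i \<in> {1..int n}. sign_word \<pi> T i < 0}"
      using T by (auto simp: sign_word_int)
  qed
  thus ?thesis by (simp add: neg_def card_image)
qed

text \<open>The letter of larger absolute value decides the comparison. The case
  \<open>i = 0\<close> counts as an ascent from the value 0.\<close>

lemma descent_sign_word_iff:
  assumes \<pi>: "\<pi> permutes {1..n}" and T: "T \<subseteq> {1..n}" and i: "i < n"
  shows "sign_word \<pi> T (int i) > sign_word \<pi> T (int (Suc i)) \<longleftrightarrow>
           (if i \<in> descents n \<pi> then i \<notin> T else Suc i \<in> T)"
proof -
  have "\<pi> (Suc i) > 0" using permutes_pos[OF \<pi>, of "Suc i"] i by simp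
  moreover have "\<pi> i \<noteq> \<pi> (Suc i)"
    using inj_eq[OF permutes_inj[OF \<pi>]] by auto
  moreover have "0 \<notin> T" using T by auto
  ultimately show ?thesis
    using i unfolding sign_word_int descents_def by auto
qed

text \<open>Each descent is charged to the larger of its two letters in absolute value. The charged
  letter is negated at an ascent of \<open>\<pi>\<close> and kept at a descent, so the count
  separates over \<open>T\<close> and its complement.\<close>

lemma des_B_sign_word:
  assumes \<pi>: "\<pi> permutes {1..n}" and T: "T \<subseteq> {1..n}"
  defines "D \<equiv> descents n \<pi>"
  shows "des_B n (sign_word \<pi> T) = card {i \<in> T. i - 1 \<notin> D} + card {i \<in> {1..n} - T. i \<in> D}"
proof -
  let ?E = "{i. i < n \<and> (if i \<in> D then i \<notin> T else Suc i \<in> T)}"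
  have "{i \<in> {0..<int n}. sign_word \<pi> T i > sign_word \<pi> T (i + 1)} = int ` ?E"
  proof (intro equalityI subsetI)
    fix j assume "j \<in> {i \<in> {0..<int n}. sign_word \<pi> T i > sign_word \<pi> T (i + 1)}"
    then obtain i where "j = int i" "i < n" "sign_word \<pi> T (int i) > sign_word \<pi> T (int (Suc i))"
      by (auto simp: add.commute elim!: nonneg_int_cases)
    thus "j \<in> int ` ?E"
      using descent_sign_word_iff[OF \<pi> T, of i] unfolding D_def by auto
  next
    fix j assume "j \<in> int ` ?E"
    then obtain i where "j = int i" "i < n" "if i \<in> D then i \<notin> T else Suc i \<in> T"
      by auto
    thus "j \<in> {i \<in> {0..<int n}. sign_word \<pi> T i > sign_word \<pi> T (i + 1)}"
      using descent_sign_word_iff[OF \<pi> T, of i] unfolding D_def by (simp add: add.commute)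
  qed
  hence "des_B n (sign_word \<pi> T) = card ?E"
    by (simp add: des_B_def card_image)
  also have "?E = {i. i < n \<and> i \<notin> D \<and> Suc i \<in> T} \<union> {i \<in> {1..n} - T. i \<in> D}"
    by (auto simp: D_def descents_def)
  also have "card \<dots> = card {i. i < n \<and> i \<notin> D \<and> Suc i \<in> T} + card {i \<in> {1..n} - T. i \<in> D}"
    by (rule card_Un_disjoint) auto
  also have "card {i. i < n \<and> i \<notin> D \<and> Suc i \<in> T} = card (Suc ` {i. i < n \<and> i \<notin> D \<and> Suc i \<in> T})"
    by (simp add: card_image)
  \<comment> \<open>The shift passes from an ascent to the letter on its right. Since
    \<open>T\<close> contains no 0, \<open>i - 1\<close> is never truncated.\<close>
  also have "Suc ` {i. i < n \<and> i \<notin> D \<and> Suc i \<in> T} = {i \<in> T. i - 1 \<notin> D}"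
  proof (intro equalityI subsetI)
    fix i assume i: "i \<in> {i \<in> T. i - 1 \<notin> D}"
    hence "i \<in> {1..n}" using T by blast
    hence "i = Suc (i - 1)" "i - 1 < n" by auto
    thus "i \<in> Suc ` {i. i < n \<and> i \<notin> D \<and> Suc i \<in> T}"
      using i by (intro image_eqI[of _ _ "i - 1"]) auto
  qed auto
  finally show ?thesis .
qed

text \<open>The sum over \<open>T\<close> is the expansion of a product of binomials: in factor
  \<open>i\<close>, the first summand stands for negating the letter, the second for keeping
  it.\<close>

lemma sum_signings:
  fixes u v :: "'a::comm_semiring_1"
  assumes \<pi>: "\<pi> permutes {1..n}"
  defines "D \<equiv> descents n \<pi>"
  shows "(\<Sum>\<sigma>\<in>signings n \<pi>. u ^ neg n \<sigma> * v ^ des_B n \<sigma>) =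
           (\<Prod>i=1..n. u * (if i - 1 \<notin> D then v else 1) + (if i \<in> D then v else 1))"
proof -
  have "(\<Sum>\<sigma>\<in>signings n \<pi>. u ^ neg n \<sigma> * v ^ des_B n \<sigma>) =
        (\<Sum>T\<in>Pow {1..n}. u ^ neg n (sign_word \<pi> T) * v ^ des_B n (sign_word \<pi> T))"
    unfolding signings_eq[OF \<pi>] by (simp only: sum.reindex[OF inj_on_sign_word[OF \<pi>]] o_def)
  also have "\<dots> = (\<Sum>T\<in>Pow {1..n}. (\<Prod>i\<in>T. u * (if i - 1 \<notin> D then v else 1)) *
                     (\<Prod>i\<in>{1..n} - T. if i \<in> D then v else 1))"
  proof (rule sum.cong[OF refl])
    fix T assume "T \<in> Pow {1..n}"
    hence T: "T \<subseteq> {1..n}" "finite T" by (auto intro: finite_subset)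
    have "(\<Prod>i\<in>T. u * (if i - 1 \<notin> D then v else 1)) = u ^ card T * v ^ card {i \<in> T. i - 1 \<notin> D}"
      unfolding prod.distrib using T(2) by (subst prod_if_card) simp_all
    moreover have "(\<Prod>i\<in>{1..n} - T. if i \<in> D then v else 1) = v ^ card {i \<in> {1..n} - T. i \<in> D}"
      by (rule prod_if_card) simp
    ultimately show "u ^ neg n (sign_word \<pi> T) * v ^ des_B n (sign_word \<pi> T) =
        (\<Prod>i\<in>T. u * (if i - 1 \<notin> D then v else 1)) * (\<Prod>i\<in>{1..n} - T. if i \<in> D then v else 1)"
      using neg_sign_word[OF \<pi> T(1)] des_B_sign_word[OF \<pi> T(1)]
      by (simp only: D_def power_add mult.assoc)
  qed
  also have "\<dots> = (\<Prod>i=1..n. u * (if i - 1 \<notin> D then v else 1) + (if i \<in> D then v else 1))"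
    by (rule prod_add[symmetric]) simp
  finally show ?thesis .
qed


subsection \<open>Evaluation of the product\<close>

text \<open>While the word is in a descending run, the valley ending the run is still to come; its factor
  \<open>1 + u\<close> is supplied in advance.\<close>

lemma prod_descents:
  fixes u v y t w :: "'a::comm_ring_1"
  assumes uv: "u + v = t * w" "1 + u * v = w" "(1 + u)\<^sup>2 * v = y * t * w\<^sup>2" and "0 \<notin> D"
  shows "(\<Prod>i=1..m. u * (if i - 1 \<notin> D then v else 1) + (if i \<in> D then v else 1)) *
             (if m \<in> D then 1 + u else 1) =
           (if m \<in> D then w else 1) * w ^ m *
             ((\<Prod>i=1..m. if i \<in> D \<and> i - 1 \<notin> D then y else 1) * (\<Prod>i=1..m. if i \<in> D then t else 1))"
proof (induction m)
  case 0
  thus ?case using assms(4) by simp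
next
  case (Suc m)
  define p where "p = (\<Prod>i=1..m. u * (if i - 1 \<notin> D then v else 1) + (if i \<in> D then v else 1))"
  define q where "q = (\<Prod>i=1..m. if i \<in> D \<and> i - 1 \<notin> D then y else 1)"
  define r where "r = (\<Prod>i=1..m. if i \<in> D then t else 1)"
  have IH: "p * (if m \<in> D then 1 + u else 1) = (if m \<in> D then w else 1) * w ^ m * (q * r)"
    using Suc.IH unfolding p_def q_def r_def .
  have "p * (u * (if m \<notin> D then v else 1) + (if Suc m \<in> D then v else 1)) *
          (if Suc m \<in> D then 1 + u else 1) =
        (if Suc m \<in> D then w else 1) * w ^ Suc m *
          ((q * (if Suc m \<in> D \<and> m \<notin> D then y else 1)) * (r * (if Suc m \<in> D then t else 1)))"
  \<comment> \<open>In order, the letter at \<open>Suc m\<close> is a double descent, a valley, a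
    peak or a double ascent. A valley uses up the pending \<open>1 + u\<close>; a peak creates a new
    one, and its \<open>w\<^sup>2\<close> covers both the letter and the pending valley.\<close>
  proof (cases "m \<in> D"; cases "Suc m \<in> D")
    assume "m \<in> D" "Suc m \<in> D"
    moreover from this have "(p * (1 + u)) * (u + v) = (w * w ^ m * (q * r)) * (t * w)"
      using IH uv(1) by simp
    ultimately show ?thesis by (simp add: mult_ac)
  next
    assume "m \<in> D" "Suc m \<notin> D"
    with IH show ?thesis by (simp add: mult_ac add.commute)
  next
    assume "m \<notin> D" "Suc m \<in> D"
    moreover have "p * (u * v + v) * (1 + u) = p * ((1 + u)\<^sup>2 * v)"
      by (simp add: power2_eq_square algebra_simps)
    ultimately show ?thesis
      using IH unfolding uv(3) by (simp add: power2_eq_square mult_ac)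
  next
    assume "m \<notin> D" "Suc m \<notin> D"
    with IH uv(2) show ?thesis by (simp add: mult_ac add.commute)
  qed
  thus ?case by (simp add: p_def q_def r_def)
qed

lemma sum_signings_eq_lpk_des:
  fixes u v y t w :: "'a::comm_ring_1"
  assumes \<pi>: "\<pi> permutes {1..n}"
    and uv: "u + v = t * w" "1 + u * v = w" "(1 + u)\<^sup>2 * v = y * t * w\<^sup>2"
  shows "(\<Sum>\<sigma>\<in>signings n \<pi>. u ^ neg n \<sigma> * v ^ des_B n \<sigma>) = w ^ n * (y ^ lpk n \<pi> * t ^ des n \<pi>)"
proof -
  define D where "D = descents n \<pi>"
  \<comment> \<open>As \<open>n\<close> is not a descent, no valley is pending at the end, and both
    correction factors in \<open>prod_descents\<close> are 1.\<close>
  have D: "0 \<notin> D" "n \<notin> D" by (simp_all add: D_def descents_def)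
  have "{i \<in> {1..n}. i \<in> D \<and> i - 1 \<notin> D} = {i \<in> D. i - 1 \<notin> D}" "{i \<in> {1..n}. i \<in> D} = D"
    by (auto simp: D_def descents_def)
  hence "card {i \<in> {1..n}. i \<in> D \<and> i - 1 \<notin> D} = lpk n \<pi>" "card {i \<in> {1..n}. i \<in> D} = des n \<pi>"
    by (simp_all add: lpk_eq[OF \<pi>] D_def des_def descents_def)
  hence "(\<Prod>i=1..n. if i \<in> D \<and> i - 1 \<notin> D then y else 1) = y ^ lpk n \<pi>"
    "(\<Prod>i=1..n. if i \<in> D then t else 1) = t ^ des n \<pi>"
    by (simp_all only: prod_if_card finite_atLeastAtMost)
  moreover have "(\<Sum>\<sigma>\<in>signings n \<pi>. u ^ neg n \<sigma> * v ^ des_B n \<sigma>) =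
           (\<Prod>i=1..n. u * (if i - 1 \<notin> D then v else 1) + (if i \<in> D then v else 1))"
    unfolding D_def by (rule sum_signings[OF \<pi>])
  ultimately show ?thesis
    using prod_descents[OF uv D(1), of n] D(2) by simp
qed

text \<open>The substitution enters through equations cleared of denominators, so one statement
  serves both identities: either \<open>y\<close>, \<open>t\<close> are computed from
  \<open>u\<close>, \<open>v\<close>, or the reverse.\<close>

lemma B_poly_eq_P_lpk_des:
  fixes u v y t w :: "'a::comm_ring_1"
  assumes A: "A \<subseteq> perms n"
    and uv: "u + v = t * w" "1 + u * v = w" "(1 + u)\<^sup>2 * v = y * t * w\<^sup>2"
  shows "B_poly n A u v = w ^ n * P_lpk_des n A y t"
proof -
  have perm: "\<pi> permutes {1..n}" if "\<pi> \<in> A" for \<pi>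
    using A that by (auto simp: perms_def)
  have "finite A"
    using A by (rule finite_subset) (simp add: perms_def finite_permutations)
  hence "B_poly n A u v = (\<Sum>\<pi>\<in>A. \<Sum>\<sigma>\<in>signings n \<pi>. u ^ neg n \<sigma> * v ^ des_B n \<sigma>)"
    unfolding B_poly_def
    by (intro sum.UNION_disjoint ballI impI signings_disjoint perm)
      (simp_all add: signings_eq[OF perm])
  also have "\<dots> = (\<Sum>\<pi>\<in>A. w ^ n * (y ^ lpk n \<pi> * t ^ des n \<pi>))"
    using sum_signings_eq_lpk_des[OF perm uv] by (intro sum.cong) auto
  finally show ?thesis by (simp add: P_lpk_des_def sum_distrib_left)
qed


subsection \<open>The substitutions\<close>

lemma rat_neq_0: "1 + y_rat * t_rat \<noteq> 0" "y_rat + t_rat \<noteq> 0"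
proof -
  have "1 + y_rat * t_rat = to_fract (1 + [:[:0, 1:]:] * [:0, 1:])"
    by (simp only: y_rat_def t_rat_def to_fract_add to_fract_mult to_fract_1)
  thus "1 + y_rat * t_rat \<noteq> 0"
    by (simp add: one_pCons)
  have "y_rat + t_rat = to_fract ([:[:0, 1:]:] + [:0, 1:])"
    by (simp only: y_rat_def t_rat_def to_fract_add)
  thus "y_rat + t_rat \<noteq> 0"
    by simp
qed

text \<open>The denominators factor: \<open>4 y t = (1 + t - s) (1 + t + s)\<close> and
  \<open>4 (1 - y) t = (s - (1 - t)) (s + (1 - t))\<close>, and the numerators of \<open>u\<close> and \<open>v\<close> are half squares.\<close>

lemma u_v_equations:
  fixes u v y t s :: "'a::field_char_0"
  assumes s: "s\<^sup>2 = (1 + t)\<^sup>2 - 4 * y * t" and nz: "y \<noteq> 0" "y \<noteq> 1" "t \<noteq> 0"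
  defines "u \<equiv> (1 + t\<^sup>2 - 2 * y * t - (1 - t) * s) / (2 * (1 - y) * t)"
    and "v \<equiv> ((1 + t)\<^sup>2 - 2 * y * t - (1 + t) * s) / (2 * y * t)"
  shows "u + v = t * (1 + u * v)" "(1 + u)\<^sup>2 * v = y * t * (1 + u * v)\<^sup>2"
    "s \<noteq> 0 \<Longrightarrow> 1 + u * v \<noteq> 0"
proof -
  define a b c d where "a = 1 + t + s" "b = s + (1 - t)" "c = 1 + t - s" "d = s - (1 - t)"
  note abcd = this
  have ca: "c * a = 4 * y * t" and db: "d * b = 4 * (1 - y) * t"
    using s unfolding abcd by algebra+
  have nz': "a \<noteq> 0" "b \<noteq> 0" "c \<noteq> 0" "d \<noteq> 0"
    using ca db nz by auto
  have "2 * (1 + t\<^sup>2 - 2 * y * t - (1 - t) * s) = d\<^sup>2" "2 * ((1 + t)\<^sup>2 - 2 * y * t - (1 + t) * s) = c\<^sup>2"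
    using s unfolding abcd by algebra+
  moreover have "2 * (1 - y) * t * u = 1 + t\<^sup>2 - 2 * y * t - (1 - t) * s"
    "2 * y * t * v = (1 + t)\<^sup>2 - 2 * y * t - (1 + t) * s"
    using nz by (simp_all add: u_def v_def)
  ultimately have "d * b * u = d * d" "c * a * v = c * c"
    unfolding ca db by algebra+
  \<comment> \<open>Cancelling \<open>d\<close> and \<open>c\<close> leaves quotients of forms
    linear in \<open>t\<close> and \<open>s\<close>, from which the remaining identities
    follow.\<close>
  hence u: "u = d / b" and v: "v = c / a"
    using nz' by (simp_all add: field_simps)
  have "a * b + d * c = 4 * s"
    unfolding abcd by algebra
  hence w: "1 + u * v = 4 * s / (a * b)"
    using nz' by (simp add: u v field_simps)
  have "d * a + c * b = t * (4 * s)"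
    unfolding abcd by algebra
  thus "u + v = t * (1 + u * v)"
    unfolding w using nz' by (simp add: u v field_simps)
  have u1: "1 + u = 2 * s / b"
    using nz' by (simp add: u abcd field_simps)
  have "(1 + u)\<^sup>2 * v = (c * a) * (4 * s\<^sup>2 / (a * b)\<^sup>2)"
    unfolding u1 v using nz' by (simp add: power2_eq_square field_simps)
  thus "(1 + u)\<^sup>2 * v = y * t * (1 + u * v)\<^sup>2"
    unfolding w ca by (simp add: power2_eq_square)
  show "1 + u * v \<noteq> 0" if "s \<noteq> 0"
    unfolding w using nz' that by simp
qed

theorem theorem5p12:
  fixes n :: nat and A :: "(nat \<Rightarrow> nat) set"
  assumes "A \<subseteq> perms n"
  shows "B_poly n A y_rat t_rat =
           (1 + y_rat * t_rat) ^ n *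
           P_lpk_des n A
             ((1 + y_rat) ^ 2 * t_rat / ((y_rat + t_rat) * (1 + y_rat * t_rat)))
             ((y_rat + t_rat) / (1 + y_rat * t_rat))
       \<and> P_lpk_des n A y_ser t_ser =
           B_poly n A u_ser v_ser / (1 + u_ser * v_ser) ^ n"
proof
  show "B_poly n A y_rat t_rat =
           (1 + y_rat * t_rat) ^ n *
           P_lpk_des n A
             ((1 + y_rat) ^ 2 * t_rat / ((y_rat + t_rat) * (1 + y_rat * t_rat)))
             ((y_rat + t_rat) / (1 + y_rat * t_rat))"
    \<comment> \<open>Here the indeterminates play the roles of \<open>u\<close> and
      \<open>v\<close>, with \<open>w = 1 + y_rat * t_rat\<close>.\<close>
    using rat_neq_0 by (intro B_poly_eq_P_lpk_des[OF assms]) (simp_all add: power2_eq_square)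
next
  define s where "s = embed_ser sqrt_disc"
  have "embed_ser 4 = 2 * 2"
    using embed_ser_mult[of 2 2] by (simp add: embed_ser_2)
  hence s: "s\<^sup>2 = (1 + t_ser)\<^sup>2 - 4 * y_ser * t_ser"
    using arg_cong[OF sqrt_disc(1), of embed_ser]
    by (simp add: embed_ser_simps s_def flip: y_ser_def t_ser_def)
  note eqs = u_v_equations[OF s y_ser_neq, folded u_ser_def[folded s_def] v_ser_def[folded s_def]]
  \<comment> \<open>The constant coefficient of the root is 1.\<close>
  have "s \<noteq> 0"
    using sqrt_disc(2) by (auto simp: s_def embed_ser_def fps_eq_iff intro!: exI[of _ 0])
  hence "1 + u_ser * v_ser \<noteq> 0" by (rule eqs)
  moreover have "B_poly n A u_ser v_ser = (1 + u_ser * v_ser) ^ n * P_lpk_des n A y_ser t_ser"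
    using eqs(1,2) by (intro B_poly_eq_P_lpk_des[OF assms]) simp_all
  ultimately show "P_lpk_des n A y_ser t_ser = B_poly n A u_ser v_ser / (1 + u_ser * v_ser) ^ n"
    by simp
qed

end
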